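(* Let $\mathfrak D\subset\mathbb C$ be an arbitrary set symmetric with respect to the real axis, let $\mathcal G\subset\mathcal M^{n\times n}$ be an arbitrary matrix class, and let $\circ$ be a binary operation on $\mathcal M^{n\times n}$ such that $$(\mathbf G\circ\mathbf A)^T=\mathbf A^T\circ\mathbf G^T$$ for every $\mathbf A\in\mathcal M^{n\times n}$ and every $\mathbf G\in\mathcal G$. Then: 1. A matrix $\mathbf A$ is left $(\mathfrak D,\mathcal G,\circ)$-stable if and only if $\mathbf A^T$ is right $(\mathfrak D,\mathcal G^T,\circ)$-stable, where $\mathcal G^T=\{\mathbf G^T:\mathbf G\in\mathcal G\}$. 2. If, in addition, $\mathcal G$ is closed with respect to transposition ($\mathbf G\in\mathcal G$ if and only if $\mathbf G^T\in\mathcal G$) and $\sigma(\mathbf G\circ\mathbf A)=\sigma(\mathbf A\circ\mathbf G)$ for every $\mathbf A\in\mathcal M^{n\times n}$ and $\mathbf G\in\mathcal G$, then $\mathbf A$ is $(\mathfrak D,\mathcal G,\circ)$-stable if and only if $\mathbf A^T$ is $(\mathfrak D,\mathcal G,\circ)$-stable.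
   Context: $\mathcal M^{n\times n}$ is the set of real $n\times n$ matrices and $\sigma(\mathbf A)$ is the set of (complex) eigenvalues of $\mathbf A$. A matrix $\mathbf A\in\mathcal M^{n\times n}$ is left (right) $(\mathfrak D,\mathcal G,\circ)$-stable if $\sigma(\mathbf G\circ\mathbf A)\subset\mathfrak D$ (respectively $\sigma(\mathbf A\circ\mathbf G)\subset\mathfrak D$) for every $\mathbf G\in\mathcal G$; it is $(\mathfrak D,\mathcal G,\circ)$-stable if it is both left and right $(\mathfrak D,\mathcal G,\circ)$-stable. *)

theory Defs
  imports "Jordan_Normal_Form.Spectral_Radius"
begin

text \<open>Eigenvalues of a real matrix are taken in the complex numbers.\<close>

definition complex_spectrum :: "real mat \<Rightarrow> complex set" where
  "complex_spectrum A = spectrum (map_mat complex_of_real A)"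

definition left_stable ::
  "complex set \<Rightarrow> real mat set \<Rightarrow> (real mat \<Rightarrow> real mat \<Rightarrow> real mat) \<Rightarrow> real mat \<Rightarrow> bool" where
  "left_stable D \<G> f A \<longleftrightarrow> (\<forall>G\<in>\<G>. complex_spectrum (f G A) \<subseteq> D)"

definition right_stable ::
  "complex set \<Rightarrow> real mat set \<Rightarrow> (real mat \<Rightarrow> real mat \<Rightarrow> real mat) \<Rightarrow> real mat \<Rightarrow> bool" where
  "right_stable D \<G> f A \<longleftrightarrow> (\<forall>G\<in>\<G>. complex_spectrum (f A G) \<subseteq> D)"

definition two_sided_stable ::
  "complex set \<Rightarrow> real mat set \<Rightarrow> (real mat \<Rightarrow> real mat \<Rightarrow> real mat) \<Rightarrow> real mat \<Rightarrow> bool" where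
  "two_sided_stable D \<G> f A \<longleftrightarrow> left_stable D \<G> f A \<and> right_stable D \<G> f A"

end

theory Submission
  imports Defs
begin

text \<open>A square matrix and its transpose have the same characteristic polynomial, hence the
  same spectrum (\<open>spectrum_transpose\<close>, carried over to real matrices by
  \<open>complex_spectrum_transpose\<close>). Since transposition reverses the operation, G \<star>
  A and the product of the transposes in the opposite order have equal spectra for each G in the
  class, which gives the first equivalence. Under the extra hypotheses the transposed class is the
  class itself and left stability coincides with right stability, so each side of the second
  equivalence collapses to one side of the first.\<close>

lemma spectrum_transpose:
  fixes A :: "'a :: field mat"
  assumes "A \<in> carrier_mat n n"
  shows "spectrum (transpose_mat A) = spectrum A"
  using assms
  by (auto simp: spectrum_def eigenvalue_root_char_poly[of _ n])

text \<open>Embedding the entries into the complex numbers commutes with transposition, so the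
  result over a field applies.\<close>

lemma complex_spectrum_transpose:
  assumes "A \<in> carrier_mat n n"
  shows "complex_spectrum (transpose_mat A) = complex_spectrum A"
  using assms spectrum_transpose[of "map_mat complex_of_real A" n]
  by (simp add: complex_spectrum_def map_mat_transpose)

theorem theorem80:
  fixes n :: nat
    and D :: "complex set"
    and \<G> :: "real mat set"
    and f :: "real mat \<Rightarrow> real mat \<Rightarrow> real mat" (infixl \<open>\<star>\<close> 70)
  assumes D_sym: "\<And>z. z \<in> D \<longleftrightarrow> cnj z \<in> D"
    and G_class: "\<G> \<subseteq> carrier_mat n n"
    and f_closed: "\<And>A B. A \<in> carrier_mat n n \<Longrightarrow> B \<in> carrier_mat n n \<Longrightarrow> A \<star> B \<in> carrier_mat n n"
    and f_transpose: "\<And>A G. A \<in> carrier_mat n n \<Longrightarrow> G \<in> \<G> \<Longrightarrow>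
          transpose_mat (G \<star> A) = transpose_mat A \<star> transpose_mat G"
  shows "(\<forall>A \<in> carrier_mat n n.
            left_stable D \<G> (\<star>) A \<longleftrightarrow>
            right_stable D (transpose_mat ` \<G>) (\<star>) (transpose_mat A)) \<and>
         ((\<forall>G \<in> carrier_mat n n. G \<in> \<G> \<longleftrightarrow> transpose_mat G \<in> \<G>) \<and>
          (\<forall>A \<in> carrier_mat n n. \<forall>G \<in> \<G>. complex_spectrum (G \<star> A) = complex_spectrum (A \<star> G)) \<longrightarrow>
          (\<forall>A \<in> carrier_mat n n.
            two_sided_stable D \<G> (\<star>) A \<longleftrightarrow> two_sided_stable D \<G> (\<star>) (transpose_mat A)))"
proof -
  have transpose_stable: "left_stable D \<G> (\<star>) A \<longleftrightarrow>
      right_stable D (transpose_mat ` \<G>) (\<star>) (transpose_mat A)"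
    if A: "A \<in> carrier_mat n n" for A
  proof -
    \<comment> \<open>The left side is the spectrum of the transpose of G \<star> A; closure of the
      operation makes G \<star> A square, so transposing it keeps the spectrum.\<close>
    have "complex_spectrum (transpose_mat A \<star> transpose_mat G) = complex_spectrum (G \<star> A)"
      if "G \<in> \<G>" for G
      using complex_spectrum_transpose[OF f_closed[of G A]] f_transpose[OF A that] A that G_class
      by auto
    then show ?thesis by (simp add: left_stable_def right_stable_def)
  qed
  show ?thesis
  proof (intro conjI impI ballI)
    fix A :: "real mat" assume "A \<in> carrier_mat n n"
    then show "left_stable D \<G> (\<star>) A \<longleftrightarrow>
        right_stable D (transpose_mat ` \<G>) (\<star>) (transpose_mat A)"
      by (rule transpose_stable)
  next
    fix A :: "real mat"
    assume closed: "(\<forall>G \<in> carrier_mat n n. G \<in> \<G> \<longleftrightarrow> transpose_mat G \<in> \<G>) \<and>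
        (\<forall>A \<in> carrier_mat n n. \<forall>G \<in> \<G>. complex_spectrum (G \<star> A) = complex_spectrum (A \<star> G))"
      and A: "A \<in> carrier_mat n n"
    \<comment> \<open>This lets \<open>transpose_stable\<close> speak of the same class on both
      sides.\<close>
    have "transpose_mat ` \<G> = \<G>"
    proof
      show "transpose_mat ` \<G> \<subseteq> \<G>" using closed G_class by auto
      show "\<G> \<subseteq> transpose_mat ` \<G>"
      proof
        fix G assume "G \<in> \<G>"
        with closed G_class have "transpose_mat G \<in> \<G>" by auto
        then show "G \<in> transpose_mat ` \<G>" by (metis imageI transpose_transpose)
      qed
    qed
    \<comment> \<open>Stated for every B because it is applied both to A and to its
      transpose.\<close>
    moreover have "left_stable D \<G> (\<star>) B \<longleftrightarrow> right_stable D \<G> (\<star>) B"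
      if "B \<in> carrier_mat n n" for B
      unfolding left_stable_def right_stable_def using closed that by metis
    ultimately show "two_sided_stable D \<G> (\<star>) A \<longleftrightarrow> two_sided_stable D \<G> (\<star>) (transpose_mat A)"
      using A transpose_stable[OF A] by (simp add: two_sided_stable_def)
  qed
qed

end
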